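(* In the line-square setting described in the context, suppose that $u(1)\le a_1(1)\le 1$ and $|a_1(2)|\le 1$. Then the main sequences of Dykstra's algorithm coincide with the MAP sequence, i.e. $c_{2n-1}=a_n$ and $c_{2n}=b_n$ for all $n\ge 1$, and convergence is finite and rapid: $P_{A\cap B}(z)=a_1=b_1=a_2=b_2=\cdots$.
   Context: Line-square setting: $X=\mathbb{R}^2$ with the Euclidean inner product $\langle\cdot,\cdot\rangle$ and norm; for $x\in\mathbb{R}^2$ write $x=(x(1),x(2))$, and likewise $x_n=(x_n(1),x_n(2))$ for sequences. $z\in X$ is arbitrary. $B=[-1,1]\times[-1,1]$. $A$ is a line in $\mathbb{R}^2$ of the form $A=u+\{v\}^\perp$, where $u\in A\cap B$ satisfies $u(1)>-1$ and $u(2)=1$, and $v\in (A-A)^\perp$ satisfies $\|v\|=1$, $v(1)>0$, $v(2)>0$. $P_C$ denotes the projection onto a nonempty closed convex set $C$. Dykstra's algorithm for $(A,B,z)$: set $b_0=z$, $p_0=0$, $q_0=0$ and for $n\ge 1$ $a_n=P_A(b_{n-1}+p_{n-1})$, $p_n=b_{n-1}+p_{n-1}-a_n$, $b_n=P_B(a_n+q_{n-1})$, $q_n=a_n+q_{n-1}-b_n$. The main sequences are $(a_n)$ and $(b_n)$; the auxiliary sequences are $(p_n)$ and $(q_n)$. Method of alternating projections (MAP): $c_0=z$, and $c_{2n-1}=P_A(c_{2n-2})$, $c_{2n}=P_B(c_{2n-1})$ for $n\ge 1$. *)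

theory Defs
  imports "HOL-Analysis.Analysis"
begin

text \<open>
  Dykstra's algorithm for two sets \<open>A\<close> and \<open>B\<close> and starting point \<open>z\<close>; the metric projection
  onto a set is \<^const>\<open>closest_point\<close>. The sequence \<open>a\<close> starts at index 1, so
  \<open>dykstra_a A B z 0\<close> is left unspecified.
\<close>

fun dykstra_a dykstra_p dykstra_b dykstra_q ::
  "'a::euclidean_space set \<Rightarrow> 'a set \<Rightarrow> 'a \<Rightarrow> nat \<Rightarrow> 'a"
where
  "dykstra_a A B z (Suc n) = closest_point A (dykstra_b A B z n + dykstra_p A B z n)"
| "dykstra_p A B z 0 = 0"
| "dykstra_p A B z (Suc n) = dykstra_b A B z n + dykstra_p A B z n - dykstra_a A B z (Suc n)"
| "dykstra_b A B z 0 = z"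
| "dykstra_b A B z (Suc n) = closest_point B (dykstra_a A B z (Suc n) + dykstra_q A B z n)"
| "dykstra_q A B z 0 = 0"
| "dykstra_q A B z (Suc n) = dykstra_a A B z (Suc n) + dykstra_q A B z n - dykstra_b A B z (Suc n)"

text \<open>
  Method of alternating projections: odd-indexed terms are projections onto \<open>A\<close>,
  even-indexed ones (from index 2 on) projections onto \<open>B\<close>.
\<close>

fun alt_proj :: "'a::euclidean_space set \<Rightarrow> 'a set \<Rightarrow> 'a \<Rightarrow> nat \<Rightarrow> 'a"
where
  "alt_proj A B z 0 = z"
| "alt_proj A B z (Suc n) = closest_point (if odd (Suc n) then A else B) (alt_proj A B z n)"

definition unit_square :: "(real^2) set"
  where "unit_square = {x. x $ 1 \<in> {-1..1} \<and> x $ 2 \<in> {-1..1}}"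

text \<open>
  The difference \<open>A - A\<close> is the Minkowski difference, spelled out because \<open>-\<close> on sets is
  set difference.
\<close>

definition line_square :: "(real^2) set \<Rightarrow> (real^2) set \<Rightarrow> real^2 \<Rightarrow> real^2 \<Rightarrow> bool"
  where "line_square A B u v \<longleftrightarrow>
    B = unit_square \<and>
    A = (\<lambda>x. u + x) ` orthogonal_comp {v} \<and>
    u \<in> A \<inter> B \<and> u $ 1 > -1 \<and> u $ 2 = 1 \<and>
    v \<in> orthogonal_comp {x - y | x y. x \<in> A \<and> y \<in> A} \<and>
    norm v = 1 \<and> v $ 1 > 0 \<and> v $ 2 > 0"

end

(* The projection a of z onto A lies in B, hence is the projection of z onto the intersection.
   Then b_1 = a and q_1 = 0, while p_1 = z - a restores z: b_1 + p_1 = z. So (b, p, q) = (a, z - a, 0)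
   is a fixed state of the iteration. *)
theory Submission
  imports Defs
begin

text \<open>A minimiser of the distance over \<open>A\<close> that happens to lie in
  \<open>B\<close> still minimises over the smaller set \<open>A \<inter> B\<close>; convexity and
  closedness make the minimiser unique.\<close>

lemma closest_point_Int_eq:
  fixes A B :: "'a::euclidean_space set"
  assumes "closed A" "convex A" "closed B" "convex B" "A \<noteq> {}" "closest_point A z \<in> B"
  shows "closest_point (A \<inter> B) z = closest_point A z"
  using assms
  by (intro closest_point_unique[symmetric])
     (auto intro: convex_Int closed_Int closest_point_in_set closest_point_le)

text \<open>One simultaneous induction: each step consumes the previous \<open>b\<close>,
  \<open>p\<close> and \<open>q\<close>. The index starts at \<open>Suc 0\<close> because the state
  at 0 is \<open>b = z\<close>, \<open>p = 0\<close>; its sum \<open>b + p\<close> is already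
  \<open>z\<close>, so the first step agrees with all later ones.\<close>

lemma dykstra_stationary:
  assumes "closest_point A z \<in> A \<inter> B"
  shows "dykstra_a A B z (Suc n) = closest_point A z"
    and "dykstra_p A B z (Suc n) = z - closest_point A z"
    and "dykstra_b A B z (Suc n) = closest_point A z"
    and "dykstra_q A B z (Suc n) = 0"
  using assms by (induction n) (simp_all add: closest_point_self)

text \<open>After the first projection the iterate lies in both sets, so either projection fixes it
  and the parity of the index does not matter.\<close>

lemma alt_proj_stationary:
  assumes "closest_point A z \<in> A \<inter> B"
  shows "alt_proj A B z (Suc n) = closest_point A z"
  using assms by (induction n) (simp_all add: closest_point_self)

lemma unit_square_eq_cbox: "unit_square = cbox (vector [-1, -1]) (vector [1, 1])"
  by (auto simp: unit_square_def mem_box_cart forall_2)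

theorem theorem4p1:
  fixes A B :: "(real^2) set" and u v z :: "real^2"
  assumes "line_square A B u v"
    and "u $ 1 \<le> dykstra_a A B z 1 $ 1" and "dykstra_a A B z 1 $ 1 \<le> 1"
    and "\<bar>dykstra_a A B z 1 $ 2\<bar> \<le> 1"
  shows "(\<forall>n\<ge>1. alt_proj A B z (2 * n - 1) = dykstra_a A B z n \<and>
                 alt_proj A B z (2 * n) = dykstra_b A B z n) \<and>
         (\<forall>n\<ge>1. dykstra_a A B z n = closest_point (A \<inter> B) z \<and>
                 dykstra_b A B z n = closest_point (A \<inter> B) z)"
proof -
  have A: "A = (\<lambda>x. u + x) ` orthogonal_comp {v}" and B: "B = unit_square"
    and u: "u \<in> A" "u $ 1 > -1"
    using assms(1) by (auto simp: line_square_def)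
  have clA: "closed A" "convex A"
    unfolding A by (auto intro: closed_translation closed_subspace convex_translation
      subspace_imp_convex subspace_orthogonal_comp)
  have clB: "closed B" "convex B"
    unfolding B unit_square_eq_cbox by auto
  have "dykstra_a A B z 1 = closest_point A z" by simp
  \<comment> \<open>The lower bound on the first coordinate is the chain
    \<open>-1 < u $ 1 \<le> dykstra_a A B z 1 $ 1\<close>.\<close>
  with assms(2-4) u have inB: "closest_point A z \<in> B"
    by (auto simp: B unit_square_def abs_le_iff)
  with clA u have inAB: "closest_point A z \<in> A \<inter> B"
    by (auto intro: closest_point_in_set)
  have proj: "closest_point (A \<inter> B) z = closest_point A z"
    using clA clB u inB by (intro closest_point_Int_eq) auto
  have "alt_proj A B z (2 * n - 1) = closest_point A z" "alt_proj A B z (2 * n) = closest_point A z"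
    "dykstra_a A B z n = closest_point A z" "dykstra_b A B z n = closest_point A z"
    if n: "n \<ge> 1" for n
  proof -
    obtain m where m: "n = Suc m" using n by (cases n) auto
    \<comment> \<open>Both indices become successors, removing the truncated subtraction and
      matching \<open>alt_proj_stationary\<close>.\<close>
    have "2 * n - 1 = Suc (2 * m)" "2 * n = Suc (Suc (2 * m))" using m by auto
    then show "alt_proj A B z (2 * n - 1) = closest_point A z"
        "alt_proj A B z (2 * n) = closest_point A z"
      by (metis alt_proj_stationary[OF inAB])+
    show "dykstra_a A B z n = closest_point A z" "dykstra_b A B z n = closest_point A z"
      unfolding m by (fact dykstra_stationary[OF inAB])+
  qed
  then show ?thesis by (simp add: proj)
qed

end
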